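(* Let $m,N,k\ge1$ be integers and let $b_N=N-1$. Let $T=(A_{i-j})_{i,j=1}^N$ be a block Toeplitz matrix, where $A_s=(a_{pq}(s))_{p,q=1}^m$ are $m\times m$ matrices, $-b_N\le s\le b_N$. Then \begin{align*} \mathrm{tr}(T^k)&=\sum_{i=1}^N\sum_{j_1,\dots,j_k=-b_N}^{b_N}\mathrm{tr}(A_{j_1}\cdots A_{j_k})\prod_{l=1}^kI_{[1,N]}\Big(i+\sum_{q=1}^lj_q\Big)\,\delta_{0,\sum_{q=1}^kj_q}\\ &=\sum_{i=1}^N\sum_{j_1,\dots,j_k=-b_N}^{b_N}\sum_{t_1,\dots,t_k=1}^m a_{t_1t_2}(j_1)\cdots a_{t_kt_1}(j_k)\prod_{l=1}^kI_{[1,N]}\Big(i+\sum_{q=1}^lj_q\Big)\,\delta_{0,\sum_{q=1}^kj_q}. \end{align*}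
   Context: $T=(A_{i-j})_{i,j=1}^N$ denotes the $mN\times mN$ matrix made of $N^2$ blocks of size $m\times m$ whose $(i,j)$ block is $A_{i-j}$. $I_{[1,N]}$ is the indicator function of the interval $[1,N]$ and $\delta$ is the Kronecker delta. *)

theory Defs
  imports "Jordan_Normal_Form.Matrix" "HOL-Library.Indicator_Function" "HOL-Library.FuncSet"
begin

definition mat_trace :: "'a::comm_monoid_add mat \<Rightarrow> 'a" where
  "mat_trace M = (\<Sum>i<dim_row M. M $$ (i, i))"

(* The blocks B i j are indexed from 1, for i, j in {1..N}, whereas the entries of a
   matrix, and hence the entries inside each block, are indexed from 0. *)
definition block_mat :: "nat \<Rightarrow> nat \<Rightarrow> (nat \<Rightarrow> nat \<Rightarrow> 'a mat) \<Rightarrow> 'a mat" where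
  "block_mat m N B =
     mat (m * N) (m * N) (\<lambda>(r, c). B (r div m + 1) (c div m + 1) $$ (r mod m, c mod m))"

definition block_toeplitz :: "nat \<Rightarrow> nat \<Rightarrow> (int \<Rightarrow> 'a mat) \<Rightarrow> 'a mat" where
  "block_toeplitz m N A = block_mat m N (\<lambda>i j. A (int i - int j))"

(* The ordered product M 1 * ... * M k of m x m matrices; type mat is not a monoid,
   so prod_list is not available. *)
definition mat_prod :: "nat \<Rightarrow> nat \<Rightarrow> (nat \<Rightarrow> 'a::semiring_1 mat) \<Rightarrow> 'a mat" where
  "mat_prod m k M = foldr (\<lambda>l P. M l * P) [1..<Suc k] (1\<^sub>m m)"

definition kronecker :: "'b \<Rightarrow> 'b \<Rightarrow> 'a::zero_neq_one" where
  "kronecker x y = (if x = y then 1 else 0)"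

end

theory Submission
  imports Defs
begin

text \<open>
  Both right-hand sides and the trace of \<open>T ^ k\<close> are sums over closed walks of length \<open>k\<close>.  The
  trace of an ordered product of \<open>k\<close> square matrices is the sum, over all cyclic sequences of \<open>k\<close>
  indices, of the products of the entries met along the way
  (\<open>mat_trace_mat_prod_closed_walks\<close>).  For the blocks \<open>A (j 1), \<dots>, A (j k)\<close> this gives the second
  equality at once.

  For the first equality the same expansion is applied to \<open>T\<close> itself.  A row index of \<open>T\<close> is a pair
  of a block position and an index inside the block, so a closed walk on the indices of \<open>T\<close> is a
  closed walk \<open>x\<close> of block positions in \<open>{1..N}\<close> together with a closed walk \<open>t\<close> of inner indices
  (\<open>sum_walks_split_blocks\<close>).  The factor picked up at step \<open>l\<close> is an entry of the block
  \<open>A (x l - x (l + 1))\<close>, where \<open>k + 1\<close> is read as \<open>1\<close>, and summing over \<open>t\<close> turns the product of these entries back into the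
  trace of a product of blocks.

  What remains is to describe a closed walk by its starting point and its steps
  (\<open>sum_closed_walks_by_steps\<close>).  The step at \<open>l\<close> is \<open>j l = x l - x (l + 1)\<close>, so the positions
  visited are \<open>x 1 - (j 1 + \<dots> + j l)\<close>, with a minus sign where the formula has a plus sign.  The
  reflection \<open>y \<mapsto> N + 1 - y\<close> of \<open>{1..N}\<close> repairs this: in terms of \<open>i = N + 1 - x 1\<close>, the reflected
  positions are \<open>i + (j 1 + \<dots> + j l)\<close>.  The indicators say that the walk stays in \<open>{1..N}\<close>, and the
  Kronecker delta says that it is closed.  Since any two positions differ by at most \<open>N - 1\<close>, the
  range of the steps is no further restriction.
\<close>

section \<open>Traces of matrix products as sums over closed walks\<close>

definition cyclic_succ :: "nat \<Rightarrow> nat \<Rightarrow> nat" where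
  "cyclic_succ k l = (if l = k then 1 else l + 1)"

lemma cyclic_succ_in: "l \<in> {1..k} \<Longrightarrow> cyclic_succ k l \<in> {1..k}"
  by (auto simp: cyclic_succ_def)

lemma foldr_mat_mult_carrier:
  assumes "\<And>l. l \<in> set ls \<Longrightarrow> M l \<in> carrier_mat n n" and "Q \<in> carrier_mat n n"
  shows "foldr (\<lambda>l P. M l * P) ls Q \<in> carrier_mat n n"
  using assms by (induction ls) (auto intro!: mult_carrier_mat)

lemma foldr_mat_mult_accumulator:
  fixes M :: "nat \<Rightarrow> 'a::semiring_1 mat"
  assumes "\<And>l. l \<in> set ls \<Longrightarrow> M l \<in> carrier_mat n n" and "Q \<in> carrier_mat n n"
  shows "foldr (\<lambda>l P. M l * P) ls Q = foldr (\<lambda>l P. M l * P) ls (1\<^sub>m n) * Q"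
  using assms(1)
proof (induction ls)
  case Nil
  then show ?case using assms(2) by simp
next
  case (Cons l ls)
  have "foldr (\<lambda>l P. M l * P) ls (1\<^sub>m n) \<in> carrier_mat n n"
    using Cons.prems by (intro foldr_mat_mult_carrier) auto
  moreover have "M l \<in> carrier_mat n n" using Cons.prems by simp
  ultimately show ?case
    using Cons assms(2) by (simp add: assoc_mult_mat[of _ n n _ n _ n])
qed

lemma mat_prod_carrier:
  assumes "\<And>l. l \<in> {1..k} \<Longrightarrow> M l \<in> carrier_mat n n"
  shows "mat_prod n k M \<in> carrier_mat n n"
  unfolding mat_prod_def using assms by (intro foldr_mat_mult_carrier) auto

lemma mat_prod_0: "mat_prod n 0 M = 1\<^sub>m n"
  by (simp add: mat_prod_def)

lemma mat_prod_Suc: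
  assumes "\<And>l. l \<in> {1..Suc k} \<Longrightarrow> M l \<in> carrier_mat n n"
  shows "mat_prod n (Suc k) M = mat_prod n k M * M (Suc k)"
proof -
  have c: "M (Suc k) \<in> carrier_mat n n" using assms by simp
  have "mat_prod n (Suc k) M = foldr (\<lambda>l P. M l * P) [1..<Suc k] (M (Suc k))"
    using c by (simp add: mat_prod_def)
  also have "\<dots> = mat_prod n k M * M (Suc k)"
    unfolding mat_prod_def using assms c by (intro foldr_mat_mult_accumulator) auto
  finally show ?thesis .
qed

lemma pow_mat_eq_mat_prod:
  assumes "T \<in> carrier_mat n n"
  shows "T ^\<^sub>m k = mat_prod n k (\<lambda>_. T)"
proof (induction k)
  case 0
  then show ?case using assms by (simp add: mat_prod_0)
next
  case (Suc k)
  then show ?case using assms by (simp add: mat_prod_Suc)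
qed

lemma sum_PiE_atLeastAtMost_Suc:
  fixes f :: "(nat \<Rightarrow> 'b) \<Rightarrow> 'c::comm_monoid_add"
  shows "(\<Sum>r \<in> {1..Suc k} \<rightarrow>\<^sub>E B. f r) = (\<Sum>s\<in>B. \<Sum>r \<in> {1..k} \<rightarrow>\<^sub>E B. f (r(Suc k := s)))"
proof -
  have I: "{1..Suc k} = insert (Suc k) {1..k}" by auto
  have "(\<Sum>r \<in> {1..Suc k} \<rightarrow>\<^sub>E B. f r)
      = (\<Sum>(s, r) \<in> B \<times> ({1..k} \<rightarrow>\<^sub>E B). f (r(Suc k := s)))"
    unfolding I PiE_insert_eq
    by (subst sum.reindex[OF inj_combinator]) (auto simp: case_prod_unfold)
  then show ?thesis by (simp add: sum.cartesian_product)
qed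

text \<open>
  A walk from \<open>p\<close> to \<open>q\<close> of length \<open>k\<close> is stored as its first \<open>k\<close> vertices \<open>r\<close>, the endpoint \<open>q\<close>
  being appended as vertex \<open>k + 1\<close>.  Testing the start of the extended walk, rather than of \<open>r\<close>,
  makes the formula correct for \<open>k = 0\<close>, where it gives the identity matrix.
\<close>

lemma mat_prod_entry_walks:
  fixes M :: "nat \<Rightarrow> 'a::comm_ring_1 mat"
  assumes "\<And>l. l \<in> {1..k} \<Longrightarrow> M l \<in> carrier_mat n n" and "p < n" and "q < n"
  shows "mat_prod n k M $$ (p, q) =
    (\<Sum>r \<in> {1..k} \<rightarrow>\<^sub>E {..<n}. if (r(Suc k := q)) 1 = p
       then \<Prod>l = 1..k. M l $$ (r l, (r(Suc k := q)) (Suc l)) else 0)"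
  using assms(1,3)
proof (induction k arbitrary: q)
  case 0
  then show ?case using \<open>p < n\<close> by (auto simp: mat_prod_0)
next
  case (Suc k)
  have "mat_prod n (Suc k) M $$ (p, q) = (\<Sum>s<n. mat_prod n k M $$ (p, s) * M (Suc k) $$ (s, q))"
  proof -
    have "mat_prod n k M \<in> carrier_mat n n" using Suc.prems by (intro mat_prod_carrier) auto
    moreover have "M (Suc k) \<in> carrier_mat n n" using Suc.prems by simp
    ultimately have "(mat_prod n k M * M (Suc k)) $$ (p, q)
        = (\<Sum>s<n. mat_prod n k M $$ (p, s) * M (Suc k) $$ (s, q))"
      using \<open>p < n\<close> \<open>q < n\<close> by (simp add: scalar_prod_def atLeast0LessThan)
    moreover have "mat_prod n (Suc k) M = mat_prod n k M * M (Suc k)"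
      using Suc.prems(1) by (rule mat_prod_Suc)
    ultimately show ?thesis by simp
  qed
  also have "\<dots> = (\<Sum>s<n. \<Sum>r \<in> {1..k} \<rightarrow>\<^sub>E {..<n}. if (r(Suc k := s)) 1 = p
       then (\<Prod>l = 1..k. M l $$ (r l, (r(Suc k := s)) (Suc l))) * M (Suc k) $$ (s, q) else 0)"
    using Suc by (auto simp: sum_distrib_right if_distrib intro!: sum.cong)
  also have "\<dots> = (\<Sum>s<n. \<Sum>r \<in> {1..k} \<rightarrow>\<^sub>E {..<n}.
       if (r(Suc k := s, Suc (Suc k) := q)) 1 = p
       then \<Prod>l = 1..Suc k. M l $$ ((r(Suc k := s)) l, (r(Suc k := s, Suc (Suc k) := q)) (Suc l))
       else 0)"
    by (intro sum.cong refl if_cong) (auto intro!: prod.cong arg_cong2[where f = "(*)"])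
  also have "\<dots> = (\<Sum>r \<in> {1..Suc k} \<rightarrow>\<^sub>E {..<n}. if (r(Suc (Suc k) := q)) 1 = p
       then \<Prod>l = 1..Suc k. M l $$ (r l, (r(Suc (Suc k) := q)) (Suc l)) else 0)"
    by (rule sum_PiE_atLeastAtMost_Suc[symmetric])
  finally show ?case .
qed

lemma mat_trace_mat_prod_closed_walks:
  fixes M :: "nat \<Rightarrow> 'a::comm_ring_1 mat"
  assumes M: "\<And>l. l \<in> {1..k} \<Longrightarrow> M l \<in> carrier_mat n n" and "k \<ge> 1"
  shows "mat_trace (mat_prod n k M) =
    (\<Sum>r \<in> {1..k} \<rightarrow>\<^sub>E {..<n}. \<Prod>l = 1..k. M l $$ (r l, r (cyclic_succ k l)))"
proof -
  have "mat_prod n k M \<in> carrier_mat n n" using M by (rule mat_prod_carrier)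
  then have "mat_trace (mat_prod n k M) = (\<Sum>p<n. mat_prod n k M $$ (p, p))"
    by (simp add: mat_trace_def)
  also have "\<dots> = (\<Sum>p<n. \<Sum>r \<in> {1..k} \<rightarrow>\<^sub>E {..<n}. if r 1 = p
       then \<Prod>l = 1..k. M l $$ (r l, (r(Suc k := p)) (Suc l)) else 0)"
    using M \<open>k \<ge> 1\<close> by (intro sum.cong refl) (subst mat_prod_entry_walks, auto)
  also have "\<dots> = (\<Sum>r \<in> {1..k} \<rightarrow>\<^sub>E {..<n}. \<Sum>p<n. if r 1 = p
       then \<Prod>l = 1..k. M l $$ (r l, (r(Suc k := p)) (Suc l)) else 0)"
    by (rule sum.swap)
  also have "\<dots> = (\<Sum>r \<in> {1..k} \<rightarrow>\<^sub>E {..<n}. \<Prod>l = 1..k. M l $$ (r l, (r(Suc k := r 1)) (Suc l)))"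
  proof (intro sum.cong refl)
    fix r assume "r \<in> {1..k} \<rightarrow>\<^sub>E {..<n}"
    then have "r 1 < n" using \<open>k \<ge> 1\<close> by (auto simp: PiE_iff)
    then show "(\<Sum>p<n. if r 1 = p
        then \<Prod>l = 1..k. M l $$ (r l, (r(Suc k := p)) (Suc l)) else 0)
      = (\<Prod>l = 1..k. M l $$ (r l, (r(Suc k := r 1)) (Suc l)))"
      by (subst sum.delta') auto
  qed
  also have "\<dots> = (\<Sum>r \<in> {1..k} \<rightarrow>\<^sub>E {..<n}. \<Prod>l = 1..k. M l $$ (r l, r (cyclic_succ k l)))"
    by (intro sum.cong prod.cong refl) (auto simp: cyclic_succ_def)
  finally show ?thesis .
qed

corollary mat_trace_mat_prod_closed_walks_from_1:
  fixes M :: "nat \<Rightarrow> 'a::comm_ring_1 mat"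
  assumes "\<And>l. l \<in> {1..k} \<Longrightarrow> M l \<in> carrier_mat n n" and "k \<ge> 1"
  shows "mat_trace (mat_prod n k M) =
    (\<Sum>t \<in> {1..k} \<rightarrow>\<^sub>E {1..n}. \<Prod>l = 1..k. M l $$ (t l - 1, t (cyclic_succ k l) - 1))"
proof -
  have "mat_trace (mat_prod n k M) =
      (\<Sum>r \<in> {1..k} \<rightarrow>\<^sub>E {..<n}. \<Prod>l = 1..k. M l $$ (r l, r (cyclic_succ k l)))"
    using assms by (rule mat_trace_mat_prod_closed_walks)
  also have "\<dots> = (\<Sum>t \<in> {1..k} \<rightarrow>\<^sub>E {1..n}.
      \<Prod>l = 1..k. M l $$ (t l - 1, t (cyclic_succ k l) - 1))"
  proof (rule sum.reindex_bij_witness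
      [where j = "\<lambda>r. \<lambda>l\<in>{1..k}. r l + 1" and i = "\<lambda>t. \<lambda>l\<in>{1..k}. t l - 1"])
    fix r assume "r \<in> {1..k} \<rightarrow>\<^sub>E {..<n}"
    then show "(\<lambda>l\<in>{1..k}. (\<lambda>l\<in>{1..k}. r l + 1) l - 1) = r"
      and "(\<lambda>l\<in>{1..k}. r l + 1) \<in> {1..k} \<rightarrow>\<^sub>E {1..n}"
      by (auto simp: PiE_iff extensional_def fun_eq_iff Suc_le_eq)
    show "(\<Prod>l = 1..k. M l $$ ((\<lambda>l\<in>{1..k}. r l + 1) l - 1,
          (\<lambda>l\<in>{1..k}. r l + 1) (cyclic_succ k l) - 1))
        = (\<Prod>l = 1..k. M l $$ (r l, r (cyclic_succ k l)))"
      by (intro prod.cong refl) (simp only: restrict_apply' cyclic_succ_in add_diff_cancel_right')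
  next
    fix t assume "t \<in> {1..k} \<rightarrow>\<^sub>E {1..n}"
    then have t: "\<And>l. l \<in> {1..k} \<Longrightarrow> t l \<in> {1..n}" "t \<in> extensional {1..k}"
      unfolding PiE_iff by blast+
    show "(\<lambda>l\<in>{1..k}. t l - 1) \<in> {1..k} \<rightarrow>\<^sub>E {..<n}"
      using t(1) by fastforce
    show "(\<lambda>l\<in>{1..k}. (\<lambda>l\<in>{1..k}. t l - 1) l + 1) = t"
    proof
      fix l show "(\<lambda>l\<in>{1..k}. (\<lambda>l\<in>{1..k}. t l - 1) l + 1) l = t l"
        using t(1)[of l] t(2) by (cases "l \<in> {1..k}") (auto simp: extensional_def)
    qed
  qed
  finally show ?thesis .
qed

section \<open>Splitting a walk on block indices\<close>

text \<open>
  Block positions are integers, because their differences index the blocks of a Toeplitz matrix.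
  Position \<open>y\<close> and inner index \<open>s\<close>, both counted from 1, name the row \<open>m * (y - 1) + (s - 1)\<close>
  counted from 0, and division by \<open>m\<close> with remainder recovers the pair.
\<close>

lemma block_index_less:
  assumes "y \<in> {1..int N}" "s \<in> {1..m}"
  shows "m * nat (y - 1) + (s - 1) < m * N"
proof -
  have "s - 1 < m" using assms by auto
  then have "m * nat (y - 1) + (s - 1) < m * (nat (y - 1) + 1)"
    by (simp only: distrib_left mult_1_right add_less_cancel_left)
  also have "\<dots> \<le> m * N" using assms by (intro mult_le_mono2) auto
  finally show ?thesis .
qed

lemma block_index_div:
  assumes "y \<in> {1..int N}" "s \<in> {1..m}"
  shows "int ((m * nat (y - 1) + (s - 1)) div m) + 1 = y"
proof -
  have "(m * n + v) div m = n" if "v < m" for n v using that by simp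
  moreover have "s - 1 < m" using assms by auto
  ultimately have "(m * nat (y - 1) + (s - 1)) div m = nat (y - 1)" by blast
  then show ?thesis using assms by simp
qed

lemma block_index_mod:
  fixes m n s :: nat
  assumes "s \<in> {1..m}"
  shows "(m * n + (s - 1)) mod m = s - 1"
proof -
  have "s - 1 < m" using assms by auto
  then show ?thesis by (simp only: mod_mult_self4 mod_less)
qed

lemma sum_walks_split_blocks:
  fixes f :: "(nat \<Rightarrow> nat) \<Rightarrow> 'a::comm_monoid_add"
  assumes "m \<ge> 1"
  shows "(\<Sum>r \<in> L \<rightarrow>\<^sub>E {..<m * N}. f r) =
    (\<Sum>x \<in> L \<rightarrow>\<^sub>E {1..int N}. \<Sum>t \<in> L \<rightarrow>\<^sub>E {1..m}.
       f (\<lambda>l\<in>L. m * nat (x l - 1) + (t l - 1)))"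
proof -
  have quot_in: "u div m < N" if "u < m * N" for u
    using that by (simp add: less_mult_imp_div_less mult.commute)
  have rem_in: "u mod m < m" for u using assms by simp
  have "(\<Sum>r \<in> L \<rightarrow>\<^sub>E {..<m * N}. f r) =
    (\<Sum>(x, t) \<in> (L \<rightarrow>\<^sub>E {1..int N}) \<times> (L \<rightarrow>\<^sub>E {1..m}). f (\<lambda>l\<in>L. m * nat (x l - 1) + (t l - 1)))"
  proof (rule sum.reindex_bij_witness
      [where j = "\<lambda>r. (\<lambda>l\<in>L. int (r l div m) + 1, \<lambda>l\<in>L. r l mod m + 1)"
         and i = "\<lambda>(x, t). \<lambda>l\<in>L. m * nat (x l - 1) + (t l - 1)"])
    fix r assume r: "r \<in> L \<rightarrow>\<^sub>E {..<m * N}"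
    show inv: "(case (\<lambda>l\<in>L. int (r l div m) + 1, \<lambda>l\<in>L. r l mod m + 1) of
        (x, t) \<Rightarrow> \<lambda>l\<in>L. m * nat (x l - 1) + (t l - 1)) = r"
      using r by (auto simp: PiE_iff extensional_def fun_eq_iff)
    show "(\<lambda>l\<in>L. int (r l div m) + 1, \<lambda>l\<in>L. r l mod m + 1)
        \<in> (L \<rightarrow>\<^sub>E {1..int N}) \<times> (L \<rightarrow>\<^sub>E {1..m})"
      using r quot_in rem_in by (force simp: PiE_iff Suc_le_eq)
    show "(case (\<lambda>l\<in>L. int (r l div m) + 1, \<lambda>l\<in>L. r l mod m + 1) of
        (x, t) \<Rightarrow> f (\<lambda>l\<in>L. m * nat (x l - 1) + (t l - 1))) = f r"
      using inv by simp
  next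
    fix xt assume "xt \<in> (L \<rightarrow>\<^sub>E {1..int N}) \<times> (L \<rightarrow>\<^sub>E {1..m})"
    then obtain x t where xt: "xt = (x, t)" "x \<in> L \<rightarrow>\<^sub>E {1..int N}" "t \<in> L \<rightarrow>\<^sub>E {1..m}" by auto
    have x: "x l \<in> {1..int N}" and t: "t l \<in> {1..m}" if "l \<in> L" for l
      using xt that by (auto simp: PiE_iff)
    show "(case xt of (x, t) \<Rightarrow> \<lambda>l\<in>L. m * nat (x l - 1) + (t l - 1)) \<in> L \<rightarrow>\<^sub>E {..<m * N}"
      unfolding xt(1) using block_index_less x t by auto
    have "(\<lambda>l\<in>L. int ((\<lambda>l\<in>L. m * nat (x l - 1) + (t l - 1)) l div m) + 1) = x"
    proof
      fix l show "(\<lambda>l\<in>L. int ((\<lambda>l\<in>L. m * nat (x l - 1) + (t l - 1)) l div m) + 1) l = x l"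
      proof (cases "l \<in> L")
        case True
        then show ?thesis using block_index_div[OF x t, of l l] by simp
      next
        case False
        then show ?thesis using xt(2) by (auto simp: PiE_iff extensional_def)
      qed
    qed
    moreover have "(\<lambda>l\<in>L. (\<lambda>l\<in>L. m * nat (x l - 1) + (t l - 1)) l mod m + 1) = t"
    proof
      fix l show "(\<lambda>l\<in>L. (\<lambda>l\<in>L. m * nat (x l - 1) + (t l - 1)) l mod m + 1) l = t l"
      proof (cases "l \<in> L")
        case True
        show ?thesis
          unfolding restrict_apply'[OF True] block_index_mod[OF t[OF True]]
          using t[OF True] by simp
      next
        case False
        then show ?thesis using xt(3) by (auto simp: PiE_iff extensional_def)
      qed
    qed
    ultimately show "(\<lambda>l\<in>L. int ((case xt of (x, t) \<Rightarrow> \<lambda>l\<in>L. m * nat (x l - 1) + (t l - 1)) l div m) + 1,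
        \<lambda>l\<in>L. (case xt of (x, t) \<Rightarrow> \<lambda>l\<in>L. m * nat (x l - 1) + (t l - 1)) l mod m + 1) = xt"
      unfolding xt(1) by simp
  qed
  then show ?thesis by (simp add: sum.cartesian_product)
qed

lemma block_toeplitz_carrier: "block_toeplitz m N A \<in> carrier_mat (m * N) (m * N)"
  by (simp add: block_toeplitz_def block_mat_def)

lemma block_toeplitz_entry:
  assumes "y \<in> {1..int N}" "z \<in> {1..int N}" "u \<in> {1..m}" "v \<in> {1..m}"
  shows "block_toeplitz m N A $$ (m * nat (y - 1) + (u - 1), m * nat (z - 1) + (v - 1))
    = A (y - z) $$ (u - 1, v - 1)"
proof -
  define r c where "r = m * nat (y - 1) + (u - 1)" and "c = m * nat (z - 1) + (v - 1)"
  have "block_toeplitz m N A $$ (r, c)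
      = A ((int (r div m) + 1) - (int (c div m) + 1)) $$ (r mod m, c mod m)"
    using block_index_less[OF assms(1,3)] block_index_less[OF assms(2,4)]
    by (simp add: block_toeplitz_def block_mat_def r_def[symmetric] c_def[symmetric]
        del: One_nat_def)
  then show ?thesis
    unfolding r_def c_def block_index_div[OF assms(1,3)] block_index_div[OF assms(2,4)]
      block_index_mod[OF assms(3)] block_index_mod[OF assms(4)] .
qed

section \<open>Closed walks described by their steps\<close>

lemma sum_cyclic_differences_prefix:
  fixes x :: "nat \<Rightarrow> 'a::ab_group_add"
  assumes "1 \<le> l" "l \<le> k"
  shows "(\<Sum>q\<in>{1..<l}. x q - x (cyclic_succ k q)) = x 1 - x l"
proof -
  have "(\<Sum>q\<in>{1..<l}. x q - x (cyclic_succ k q)) = (\<Sum>q\<in>{1..<l}. x q - x (Suc q))"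
    using assms by (intro sum.cong) (auto simp: cyclic_succ_def)
  also have "\<dots> = x 1 - x l"
    using assms(1) by (induction l rule: dec_induct) auto
  finally show ?thesis .
qed

lemma sum_cyclic_differences:
  fixes x :: "nat \<Rightarrow> 'a::ab_group_add"
  assumes "1 \<le> l" "l \<le> k"
  shows "(\<Sum>q = 1..l. x q - x (cyclic_succ k q)) = x 1 - x (cyclic_succ k l)"
proof -
  have "{1..l} = insert l {1..<l}" using assms by auto
  then have "(\<Sum>q = 1..l. x q - x (cyclic_succ k q))
      = (x l - x (cyclic_succ k l)) + (\<Sum>q\<in>{1..<l}. x q - x (cyclic_succ k q))"
    by simp
  then show ?thesis unfolding sum_cyclic_differences_prefix[OF assms] by simp
qed

lemma prod_indicator:
  assumes "finite L"
  shows "(\<Prod>l\<in>L. indicator S (g l)) = (if \<forall>l\<in>L. g l \<in> S then 1 else (0::'a::comm_ring_1))"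
  using assms by (induction L rule: finite_induct) (auto simp: indicator_def)

text \<open>
  The start \<open>i\<close> and the steps \<open>j\<close> encode the walk \<open>x l = N + 1 - (i + (j 1 + \<dots> + j (l - 1)))\<close>.
  The reflection in \<open>N + 1\<close> makes the steps \<open>j l = x l - x (l + 1)\<close>, the order of subtraction in
  a Toeplitz matrix, while the partial sums keep their positive sign.
\<close>

lemma sum_closed_walks_by_steps:
  fixes F :: "(nat \<Rightarrow> int) \<Rightarrow> 'a::comm_ring_1"
  assumes "k \<ge> 1" and b: "b = int N - 1"
  shows "(\<Sum>i = 1..int N. \<Sum>j \<in> {1..k} \<rightarrow>\<^sub>E {-b..b}.
      F j * (\<Prod>l = 1..k. indicator {1..int N} (i + (\<Sum>q = 1..l. j q)))
          * kronecker 0 (\<Sum>q = 1..k. j q))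
    = (\<Sum>x \<in> {1..k} \<rightarrow>\<^sub>E {1..int N}. F (\<lambda>l\<in>{1..k}. x l - x (cyclic_succ k l)))"
proof -
  define J where "J = {1..k} \<rightarrow>\<^sub>E {-b..b}"
  define C where "C = (\<lambda>(i::int, j). (\<forall>l\<in>{1..k}. i + (\<Sum>q = 1..l. j q) \<in> {1..int N})
      \<and> (\<Sum>q = 1..k. j q) = (0::int))"
  have fin: "finite J" unfolding J_def by (intro finite_PiE) auto
  have "(\<Sum>i = 1..int N. \<Sum>j\<in>J.
      F j * (\<Prod>l = 1..k. indicator {1..int N} (i + (\<Sum>q = 1..l. j q)))
          * kronecker 0 (\<Sum>q = 1..k. j q))
    = (\<Sum>(i, j) \<in> {1..int N} \<times> J. if C (i, j) then F j else 0)"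
    unfolding sum.cartesian_product
    by (intro sum.cong refl) (auto simp: prod_indicator C_def kronecker_def)
  also have "\<dots> = (\<Sum>ij \<in> {1..int N} \<times> J. if C ij then F (snd ij) else 0)"
    by (simp add: case_prod_unfold)
  also have "\<dots> = (\<Sum>ij \<in> {ij \<in> {1..int N} \<times> J. C ij}. F (snd ij))"
    using fin by (intro sum.inter_filter[symmetric]) auto
  also have "\<dots> = (\<Sum>x \<in> {1..k} \<rightarrow>\<^sub>E {1..int N}. F (\<lambda>l\<in>{1..k}. x l - x (cyclic_succ k l)))"
  proof (rule sum.reindex_bij_witness
      [where j = "\<lambda>(i, j). \<lambda>l\<in>{1..k}. int N + 1 - (i + (\<Sum>q\<in>{1..<l}. j q))"
         and i = "\<lambda>x. (int N + 1 - x 1, \<lambda>l\<in>{1..k}. x l - x (cyclic_succ k l))"])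
    fix ij assume "ij \<in> {ij \<in> {1..int N} \<times> J. C ij}"
    then obtain i j where ij: "ij = (i, j)" "i \<in> {1..int N}" "j \<in> J"
      and stay: "\<And>l. l \<in> {1..k} \<Longrightarrow> i + (\<Sum>q = 1..l. j q) \<in> {1..int N}"
      and closed: "(\<Sum>q = 1..k. j q) = 0"
      by (auto simp: C_def)
    define x where "x = (\<lambda>l\<in>{1..k}. int N + 1 - (i + (\<Sum>q\<in>{1..<l}. j q)))"
    have x_eq: "(case ij of (i, j) \<Rightarrow> \<lambda>l\<in>{1..k}. int N + 1 - (i + (\<Sum>q\<in>{1..<l}. j q))) = x"
      by (simp add: ij(1) x_def)
    have step: "x l - x (cyclic_succ k l) = j l" if "l \<in> {1..k}" for l
    proof -
      have l: "{1..l} = insert l {1..<l}" using that by auto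
      show ?thesis
      proof (cases "l = k")
        case True
        (* The last step returns to the start because the steps add up to zero. *)
        then show ?thesis using closed l that \<open>k \<ge> 1\<close> by (auto simp: x_def cyclic_succ_def)
      next
        case False
        have "{1..<Suc l} = insert l {1..<l}" using that by auto
        then show ?thesis using False that by (simp add: x_def cyclic_succ_def)
      qed
    qed
    have steps: "(\<lambda>l\<in>{1..k}. x l - x (cyclic_succ k l)) = j"
    proof
      fix l show "(\<lambda>l\<in>{1..k}. x l - x (cyclic_succ k l)) l = j l"
        using step[of l] ij(3) by (cases "l \<in> {1..k}") (auto simp: J_def PiE_iff extensional_def)
    qed
    show "(int N + 1 - (case ij of (i, j) \<Rightarrow> \<lambda>l\<in>{1..k}. int N + 1 - (i + (\<Sum>q\<in>{1..<l}. j q))) 1,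
        \<lambda>l\<in>{1..k}. (case ij of (i, j) \<Rightarrow> \<lambda>l\<in>{1..k}. int N + 1 - (i + (\<Sum>q\<in>{1..<l}. j q))) l
          - (case ij of (i, j) \<Rightarrow> \<lambda>l\<in>{1..k}. int N + 1 - (i + (\<Sum>q\<in>{1..<l}. j q))) (cyclic_succ k l))
      = ij"
      unfolding x_eq steps using \<open>k \<ge> 1\<close> by (simp add: ij(1) x_def)
    have "x l \<in> {1..int N}" if "l \<in> {1..k}" for l
    proof (cases "l = 1")
      case True
      then show ?thesis using ij(2) that by (simp add: x_def)
    next
      case False
      then have "l - 1 \<in> {1..k}" and "{1..<l} = {1..l - 1}" using that by auto
      then show ?thesis using stay[of "l - 1"] that by (simp add: x_def)
    qed
    moreover have "x \<in> extensional {1..k}" by (simp add: x_def)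
    ultimately show "(case ij of (i, j) \<Rightarrow> \<lambda>l\<in>{1..k}. int N + 1 - (i + (\<Sum>q\<in>{1..<l}. j q)))
        \<in> {1..k} \<rightarrow>\<^sub>E {1..int N}"
      unfolding x_eq PiE_iff by blast
    show "F (\<lambda>l\<in>{1..k}. (case ij of (i, j) \<Rightarrow> \<lambda>l\<in>{1..k}. int N + 1 - (i + (\<Sum>q\<in>{1..<l}. j q))) l
          - (case ij of (i, j) \<Rightarrow> \<lambda>l\<in>{1..k}. int N + 1 - (i + (\<Sum>q\<in>{1..<l}. j q))) (cyclic_succ k l))
      = F (snd ij)"
      unfolding x_eq steps by (simp add: ij(1))
  next
    fix x assume x: "x \<in> {1..k} \<rightarrow>\<^sub>E {1..int N}"
    have x_in: "x l \<in> {1..int N}" if "l \<in> {1..k}" for l using x that by (auto simp: PiE_iff)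
    define j where "j = (\<lambda>l\<in>{1..k}. x l - x (cyclic_succ k l))"
    have prefix: "(\<Sum>q\<in>{1..<l}. j q) = x 1 - x l" if "l \<in> {1..k}" for l
    proof -
      have "(\<Sum>q\<in>{1..<l}. j q) = (\<Sum>q\<in>{1..<l}. x q - x (cyclic_succ k q))"
        using that by (intro sum.cong) (auto simp: j_def)
      then show ?thesis using that sum_cyclic_differences_prefix[of l k x] by simp
    qed
    have partial: "(\<Sum>q = 1..l. j q) = x 1 - x (cyclic_succ k l)" if "l \<in> {1..k}" for l
    proof -
      have "(\<Sum>q = 1..l. j q) = (\<Sum>q = 1..l. x q - x (cyclic_succ k q))"
        using that by (intro sum.cong) (auto simp: j_def)
      then show ?thesis using that sum_cyclic_differences[of l k x] by simp
    qed
    show "(case (int N + 1 - x 1, \<lambda>l\<in>{1..k}. x l - x (cyclic_succ k l)) of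
        (i, j) \<Rightarrow> \<lambda>l\<in>{1..k}. int N + 1 - (i + (\<Sum>q\<in>{1..<l}. j q))) = x"
    proof -
      have "(\<lambda>l\<in>{1..k}. int N + 1 - (int N + 1 - x 1 + (\<Sum>q\<in>{1..<l}. j q))) = x"
      proof
        fix l show "(\<lambda>l\<in>{1..k}. int N + 1 - (int N + 1 - x 1 + (\<Sum>q\<in>{1..<l}. j q))) l = x l"
          using prefix[of l] x by (cases "l \<in> {1..k}") (auto simp: PiE_iff extensional_def)
      qed
      then show ?thesis unfolding j_def by simp
    qed
    have "j \<in> J"
    proof -
      have "x l - x (cyclic_succ k l) \<in> {-b..b}" if "l \<in> {1..k}" for l
        using x_in[OF that] x_in[OF cyclic_succ_in[OF that]] b by auto
      then show ?thesis unfolding J_def j_def by auto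
    qed
    moreover have "int N + 1 - x 1 \<in> {1..int N}" using x_in[of 1] \<open>k \<ge> 1\<close> by auto
    moreover have "C (int N + 1 - x 1, j)"
    proof -
      have "int N + 1 - x 1 + (\<Sum>q = 1..l. j q) \<in> {1..int N}" if "l \<in> {1..k}" for l
        using partial[OF that] x_in[OF cyclic_succ_in[OF that]] by auto
      moreover have "(\<Sum>q = 1..k. j q) = 0"
        using partial[of k] \<open>k \<ge> 1\<close> by (simp add: cyclic_succ_def)
      ultimately show ?thesis unfolding C_def by blast
    qed
    ultimately show "(int N + 1 - x 1, \<lambda>l\<in>{1..k}. x l - x (cyclic_succ k l))
        \<in> {ij \<in> {1..int N} \<times> J. C ij}"
      unfolding j_def by simp
  qed
  finally show ?thesis unfolding J_def .
qed

section \<open>The trace of a power of a block Toeplitz matrix\<close>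

theorem lemma2p2:
  fixes m N k :: nat and b :: int
    and A :: "int \<Rightarrow> 'a::comm_ring_1 mat"
    and a :: "nat \<Rightarrow> nat \<Rightarrow> int \<Rightarrow> 'a"
    and T :: "'a mat"
  assumes "m \<ge> 1" and "N \<ge> 1" and "k \<ge> 1"
    and "b = int N - 1"
    and "\<And>s. s \<in> {-b..b} \<Longrightarrow> A s \<in> carrier_mat m m"
    and "\<And>s p q. s \<in> {-b..b} \<Longrightarrow> p \<in> {1..m} \<Longrightarrow> q \<in> {1..m} \<Longrightarrow> A s $$ (p - 1, q - 1) = a p q s"
    and "T = block_toeplitz m N A"
  shows "mat_trace (T ^\<^sub>m k) =
      (\<Sum>i = 1..int N. \<Sum>j \<in> {1..k} \<rightarrow>\<^sub>E {-b..b}.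
         mat_trace (mat_prod m k (\<lambda>l. A (j l)))
         * (\<Prod>l = 1..k. indicator {1..int N} (i + (\<Sum>q = 1..l. j q)))
         * kronecker 0 (\<Sum>q = 1..k. j q))
    \<and>
      (\<Sum>i = 1..int N. \<Sum>j \<in> {1..k} \<rightarrow>\<^sub>E {-b..b}.
         mat_trace (mat_prod m k (\<lambda>l. A (j l)))
         * (\<Prod>l = 1..k. indicator {1..int N} (i + (\<Sum>q = 1..l. j q)))
         * kronecker 0 (\<Sum>q = 1..k. j q)) =
      (\<Sum>i = 1..int N. \<Sum>j \<in> {1..k} \<rightarrow>\<^sub>E {-b..b}. \<Sum>t \<in> {1..k} \<rightarrow>\<^sub>E {1..m}.
         (\<Prod>l = 1..k. a (t l) (t (if l = k then 1 else l + 1)) (j l))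
         * (\<Prod>l = 1..k. indicator {1..int N} (i + (\<Sum>q = 1..l. j q)))
         * kronecker 0 (\<Sum>q = 1..k. j q))"
proof -
  note k = \<open>k \<ge> 1\<close> and b = \<open>b = int N - 1\<close> and carr = assms(5)
  define W :: "int \<Rightarrow> (nat \<Rightarrow> int) \<Rightarrow> 'a" where
    "W i j = (\<Prod>l = 1..k. indicator {1..int N} (i + (\<Sum>q = 1..l. j q)))" for i j
  have block_trace: "mat_trace (mat_prod m k (\<lambda>l. A (j l))) = (\<Sum>t \<in> {1..k} \<rightarrow>\<^sub>E {1..m}.
      \<Prod>l = 1..k. A (j l) $$ (t l - 1, t (cyclic_succ k l) - 1))"
    if "\<And>l. l \<in> {1..k} \<Longrightarrow> j l \<in> {-b..b}" for j
    using that k carr by (intro mat_trace_mat_prod_closed_walks_from_1) auto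
  have entries: "(\<Prod>l = 1..k. A (j l) $$ (t l - 1, t (cyclic_succ k l) - 1))
      = (\<Prod>l = 1..k. a (t l) (t (if l = k then 1 else l + 1)) (j l))"
    if "j \<in> {1..k} \<rightarrow>\<^sub>E {-b..b}" "t \<in> {1..k} \<rightarrow>\<^sub>E {1..m}" for j t
  proof (intro prod.cong refl)
    fix l assume l: "l \<in> {1..k}"
    then have "j l \<in> {-b..b}" "t l \<in> {1..m}" "t (cyclic_succ k l) \<in> {1..m}"
      using that cyclic_succ_in[OF l] unfolding PiE_iff by blast+
    from assms(6)[OF this]
    show "A (j l) $$ (t l - 1, t (cyclic_succ k l) - 1)
        = a (t l) (t (if l = k then 1 else l + 1)) (j l)"
      by (simp add: cyclic_succ_def)
  qed
  have T: "T \<in> carrier_mat (m * N) (m * N)"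
    unfolding assms(7) by (rule block_toeplitz_carrier)

  have "mat_trace (T ^\<^sub>m k)
      = (\<Sum>r \<in> {1..k} \<rightarrow>\<^sub>E {..<m * N}. \<Prod>l = 1..k. T $$ (r l, r (cyclic_succ k l)))"
    unfolding pow_mat_eq_mat_prod[OF T] using T k by (rule mat_trace_mat_prod_closed_walks)
  also have "\<dots> = (\<Sum>x \<in> {1..k} \<rightarrow>\<^sub>E {1..int N}. \<Sum>t \<in> {1..k} \<rightarrow>\<^sub>E {1..m}.
      \<Prod>l = 1..k. A (x l - x (cyclic_succ k l)) $$ (t l - 1, t (cyclic_succ k l) - 1))"
    unfolding sum_walks_split_blocks[OF \<open>m \<ge> 1\<close>]
  proof (intro sum.cong prod.cong refl)
    fix x t l
    assume x: "x \<in> {1..k} \<rightarrow>\<^sub>E {1..int N}" and t: "t \<in> {1..k} \<rightarrow>\<^sub>E {1..m}" and l: "l \<in> {1..k}"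
    have "x l \<in> {1..int N}" "x (cyclic_succ k l) \<in> {1..int N}"
      "t l \<in> {1..m}" "t (cyclic_succ k l) \<in> {1..m}"
      using x t l cyclic_succ_in[OF l] unfolding PiE_iff by blast+
    from block_toeplitz_entry[OF this]
    show "T $$ ((\<lambda>l\<in>{1..k}. m * nat (x l - 1) + (t l - 1)) l,
          (\<lambda>l\<in>{1..k}. m * nat (x l - 1) + (t l - 1)) (cyclic_succ k l))
        = A (x l - x (cyclic_succ k l)) $$ (t l - 1, t (cyclic_succ k l) - 1)"
      unfolding assms(7) restrict_apply'[OF l] restrict_apply'[OF cyclic_succ_in[OF l]] .
  qed
  also have "\<dots> = (\<Sum>x \<in> {1..k} \<rightarrow>\<^sub>E {1..int N}.
      mat_trace (mat_prod m k (\<lambda>l. A ((\<lambda>l\<in>{1..k}. x l - x (cyclic_succ k l)) l))))"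
  proof (intro sum.cong refl)
    fix x assume x: "x \<in> {1..k} \<rightarrow>\<^sub>E {1..int N}"
    have "(\<lambda>l\<in>{1..k}. x l - x (cyclic_succ k l)) l \<in> {-b..b}" if l: "l \<in> {1..k}" for l
    proof -
      have "x l \<in> {1..int N}" "x (cyclic_succ k l) \<in> {1..int N}"
        using x l cyclic_succ_in[OF l] unfolding PiE_iff by blast+
      then show ?thesis using l b by auto
    qed
    from block_trace[OF this]
    show "(\<Sum>t \<in> {1..k} \<rightarrow>\<^sub>E {1..m}.
        \<Prod>l = 1..k. A (x l - x (cyclic_succ k l)) $$ (t l - 1, t (cyclic_succ k l) - 1))
      = mat_trace (mat_prod m k (\<lambda>l. A ((\<lambda>l\<in>{1..k}. x l - x (cyclic_succ k l)) l)))"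
      by simp
  qed
  also have "\<dots> = (\<Sum>i = 1..int N. \<Sum>j \<in> {1..k} \<rightarrow>\<^sub>E {-b..b}.
      mat_trace (mat_prod m k (\<lambda>l. A (j l))) * W i j * kronecker 0 (\<Sum>q = 1..k. j q))"
    unfolding W_def
    by (rule sum_closed_walks_by_steps[OF k b,
          where F = "\<lambda>j. mat_trace (mat_prod m k (\<lambda>l. A (j l)))", symmetric])
  finally have first: "mat_trace (T ^\<^sub>m k) = \<dots>" .

  have second: "(\<Sum>i = 1..int N. \<Sum>j \<in> {1..k} \<rightarrow>\<^sub>E {-b..b}.
      mat_trace (mat_prod m k (\<lambda>l. A (j l))) * W i j * kronecker 0 (\<Sum>q = 1..k. j q))
    = (\<Sum>i = 1..int N. \<Sum>j \<in> {1..k} \<rightarrow>\<^sub>E {-b..b}. \<Sum>t \<in> {1..k} \<rightarrow>\<^sub>E {1..m}.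
      (\<Prod>l = 1..k. a (t l) (t (if l = k then 1 else l + 1)) (j l))
      * W i j * kronecker 0 (\<Sum>q = 1..k. j q))"
  proof (intro sum.cong refl)
    fix i j assume j: "j \<in> {1..k} \<rightarrow>\<^sub>E {-b..b}"
    then have "mat_trace (mat_prod m k (\<lambda>l. A (j l))) = (\<Sum>t \<in> {1..k} \<rightarrow>\<^sub>E {1..m}.
        \<Prod>l = 1..k. A (j l) $$ (t l - 1, t (cyclic_succ k l) - 1))"
      unfolding PiE_iff by (intro block_trace) blast
    also have "\<dots> = (\<Sum>t \<in> {1..k} \<rightarrow>\<^sub>E {1..m}.
        \<Prod>l = 1..k. a (t l) (t (if l = k then 1 else l + 1)) (j l))"
      using j by (intro sum.cong refl entries)
    finally show "mat_trace (mat_prod m k (\<lambda>l. A (j l))) * W i j * kronecker 0 (\<Sum>q = 1..k. j q)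
      = (\<Sum>t \<in> {1..k} \<rightarrow>\<^sub>E {1..m}. (\<Prod>l = 1..k. a (t l) (t (if l = k then 1 else l + 1)) (j l))
          * W i j * kronecker 0 (\<Sum>q = 1..k. j q))"
      by (simp only: sum_distrib_right)
  qed
  show ?thesis
    using first second unfolding W_def by (rule conjI)
qed

end
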